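(* Let $\mathsf{W}$ be a discrete memoryless channel with input alphabet $\{0,1\}$, discrete output alphabet $\mathcal{Y}$ and capacity $C(\mathsf{W})$, and let $p\in[0,1]$ be such that $X\sim\mathrm{Bernoulli}(p)$ is a capacity-achieving input distribution, i.e. $I(X:Y)=C(\mathsf{W})$ for $Y=\mathsf{W}(X)$. For $L=2^\ell$ let $X^L$ consist of $L$ i.i.d. copies of $X$, let $U^L=X^LG_L$, let $Y^L=\mathsf{W}^L(X^L)$, and let $\mathcal{R}_{\epsilon}=\{i\in\{1,\dots,L\}: H(U_i|U^{i-1})\ge 1-\epsilon\}$ with $\epsilon=\epsilon_L$ as in the context. Then the rate $$R:=\lim_{L\to\infty}\frac1L\left[\,|\mathcal{R}_{\epsilon}|-H\big(U^L[\mathcal{R}_{\epsilon}]\,\big|\,Y^L\big)\right]$$ satisfies $R=C(\mathsf{W})$.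
   Context: Logarithms and entropies are base 2. $\mathsf{W}^L$ denotes $L$ independent uses of $\mathsf{W}$. $G_L=\begin{pmatrix}1&0\\1&1\end{pmatrix}^{\otimes \ell}$ over $\mathbb{F}_2$, where $L=2^\ell$, acting on row vectors from the right. For a vector $u\in\mathbb{F}_2^L$ and $\mathcal{I}\subseteq\{1,\dots,L\}$, $u[\mathcal{I}]=[u_i:i\in\mathcal{I}]$ and $u^{i}=[u_1,\dots,u_i]$. Here $\epsilon=\epsilon_L=O(2^{-L^{\beta}})$ for a fixed $\beta<\frac12$ is a sequence for which (as is known from source polarization, e.g. with $\epsilon_L=2^{-L^\beta}$) $|\mathcal{R}_{\epsilon}|=L H_{\rm b}(p)-o(L)$, where $H_{\rm b}$ is the binary entropy function. The limit is over $L=2^\ell$, $\ell\to\infty$. The quantity $R$ is the asymptotic rate (in bits per use of $\mathsf{W}$) of the coding scheme consisting of a polarization-based shaper fed by outer polar codes, whose rate per block of $L$ uses of $\mathsf{W}$ is $|\mathcal{R}_\epsilon|-H(U^L[\mathcal{R}_\epsilon]|Y^L)$. *)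

theory Defs
  imports
    "HOL-Probability.Probability"
    "HOL-Library.Landau_Symbols"
    "HOL-Library.Z2"
    "Jordan_Normal_Form.Matrix"
begin

text \<open>Blocks of channel inputs and outputs are lists, so that all alphabets involved stay countable
  (unlike \<^typ>\<open>bit vec\<close> or function types) and counting measures are sigma-finite.\<close>

instance bit :: finite
proof
  have "(UNIV :: bit set) \<subseteq> {0, 1}"
  proof
    fix x :: bit
    show "x \<in> {0, 1}" by (cases x) auto
  qed
  then show "finite (UNIV :: bit set)"
    by (rule finite_subset) simp
qed


section \<open>Entropy and mutual information in bits\<close>

definition cond_entropy ::
    "'s pmf \<Rightarrow> ('s \<Rightarrow> 'a::countable) \<Rightarrow> ('s \<Rightarrow> 'b::countable) \<Rightarrow> real" where
  "cond_entropy P X Y =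
     prob_space.conditional_entropy (measure_pmf P) 2 (count_space UNIV) (count_space UNIV) X Y"

definition mutual_info ::
    "'s pmf \<Rightarrow> ('s \<Rightarrow> 'a::countable) \<Rightarrow> ('s \<Rightarrow> 'b::countable) \<Rightarrow> real" where
  "mutual_info P X Y =
     prob_space.mutual_information (measure_pmf P) 2 (count_space UNIV) (count_space UNIV) X Y"

text \<open>The endpoints follow the convention \<open>0 log 0 = 0\<close>.\<close>

definition binary_entropy :: "real \<Rightarrow> real" where
  "binary_entropy p = - p * log 2 p - (1 - p) * log 2 (1 - p)"


section \<open>Binary-input discrete memoryless channels\<close>

text \<open>A channel is the family of its output distributions, \<open>W x\<close> being the law of the output
  on input \<open>x\<close>.\<close>

definition input_output :: "'x pmf \<Rightarrow> ('x \<Rightarrow> 'y pmf) \<Rightarrow> ('x \<times> 'y) pmf" where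
  "input_output Q W = do { x \<leftarrow> Q; y \<leftarrow> W x; return_pmf (x, y) }"

primrec channel_power :: "('x \<Rightarrow> 'y pmf) \<Rightarrow> 'x list \<Rightarrow> 'y list pmf" where
  "channel_power W [] = return_pmf []"
| "channel_power W (x # xs) = do { y \<leftarrow> W x; ys \<leftarrow> channel_power W xs; return_pmf (y # ys) }"

text \<open>The supremum is over all input distributions; the values are bounded by 1 because the
  input is binary.\<close>

definition capacity :: "(bit \<Rightarrow> 'y::countable pmf) \<Rightarrow> real" where
  "capacity W = (SUP Q. mutual_info (input_output Q W) fst snd)"

definition bernoulli_bit :: "real \<Rightarrow> bit pmf" where
  "bernoulli_bit p = map_pmf of_bool (bernoulli_pmf p)"


section \<open>The polar transform\<close>

definition kronecker_prod :: "'a::times mat \<Rightarrow> 'a mat \<Rightarrow> 'a mat" where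
  "kronecker_prod A B = mat (dim_row A * dim_row B) (dim_col A * dim_col B)
     (\<lambda>(i, j). A $$ (i div dim_row B, j div dim_col B) * B $$ (i mod dim_row B, j mod dim_col B))"

primrec kronecker_power :: "'a::semiring_1 mat \<Rightarrow> nat \<Rightarrow> 'a mat" where
  "kronecker_power A 0 = 1\<^sub>m 1"
| "kronecker_power A (Suc n) = kronecker_prod A (kronecker_power A n)"

definition polar_matrix :: "nat \<Rightarrow> bit mat" where
  "polar_matrix l = kronecker_power (mat_of_rows_list 2 [[1, 0], [1, 1]]) l"

text \<open>The row vector \<open>x\<close> times the matrix, written through the transpose since the library's
  matrix-vector product acts on column vectors.\<close>

definition polar_transform :: "nat \<Rightarrow> bit list \<Rightarrow> bit list" where
  "polar_transform l x = list_of_vec (transpose_mat (polar_matrix l) *\<^sub>v vec_of_list x)"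


section \<open>Source polarization and the rate of the shaper\<close>

text \<open>Coordinates are numbered from 0: \<open>u ! i\<close> is the coordinate with 1-based index \<open>i + 1\<close>,
  \<open>take i u\<close> is the vector of all coordinates before it, and \<open>nths u I\<close> is the restriction
  of \<open>u\<close> to \<open>I\<close>.\<close>

definition high_entropy_set :: "real \<Rightarrow> nat \<Rightarrow> real \<Rightarrow> nat set" where
  "high_entropy_set p l \<epsilon> =
     {i. i < 2 ^ l \<and>
         cond_entropy (replicate_pmf (2 ^ l) (bernoulli_bit p))
           (\<lambda>x. polar_transform l x ! i) (\<lambda>x. take i (polar_transform l x)) \<ge> 1 - \<epsilon>}"

definition block_rate :: "(bit \<Rightarrow> 'y::countable pmf) \<Rightarrow> real \<Rightarrow> nat \<Rightarrow> real \<Rightarrow> real" where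
  "block_rate W p l \<epsilon> =
     (let R = high_entropy_set p l \<epsilon>;
          P = input_output (replicate_pmf (2 ^ l) (bernoulli_bit p)) (channel_power W)
      in real (card R) - cond_entropy P (\<lambda>(x, y). nths (polar_transform l x) R) (\<lambda>(x, y). y))"

end

theory Submission
  imports Defs
begin

text \<open>
  Put \<open>V = U[\<R>]\<close> for the high-entropy coordinates \<open>\<R>\<close>. Since \<open>X \<mapsto> U\<close> is injective, the chain rule gives
  \<open>H(V|Y) = H(U|Y) - H(U|V,Y) = L H(X|Y) - H(U|V,Y)\<close>, and conditioning reduces entropy, so
  \<open>0 \<le> H(U|V,Y) \<le> H(U|V) = L h(p) - H(V)\<close>. The chain rule along the coordinates of \<open>V\<close> yields
  \<open>H(V) \<ge> |\<R>| (1 - \<epsilon>)\<close>, so the polarization \<open>|\<R>| = L h(p) + o(L)\<close> makes \<open>H(U|V)\<close> sublinear. Hence the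
  rate is \<open>h(p) - H(X|Y) = I(X:Y)\<close>.

  All entropies, conditional or not, are expectations of logarithms of the probability of the event
  that a random variable repeats its actual value; unconditional entropy is entropy given a constant.
\<close>

section \<open>Entropy of discrete random variables\<close>

text \<open>A function of the sample point rather than of the value: joint and marginal
  probabilities then live on one space, and entropy identities become pointwise identities on the
  support.\<close>

definition cell_prob :: "'s pmf \<Rightarrow> ('s \<Rightarrow> 'a) \<Rightarrow> 's \<Rightarrow> real" where
  "cell_prob P X s = measure (measure_pmf P) {t. X t = X s}"

lemma cell_prob_eq_pmf: "cell_prob P X s = pmf (map_pmf X P) (X s)"
  by (auto simp: cell_prob_def pmf_map intro!: arg_cong[where f="measure _"])

lemma cell_prob_pos: "s \<in> set_pmf P \<Longrightarrow> 0 < cell_prob P X s"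
  by (simp add: cell_prob_eq_pmf pmf_positive)

lemma cell_prob_neq_0: "s \<in> set_pmf P \<Longrightarrow> cell_prob P X s \<noteq> 0"
  using cell_prob_pos[of s P X] by simp

lemma cell_prob_mono:
  assumes "\<And>t. X t = X s \<Longrightarrow> Y t = Y s"
  shows "cell_prob P X s \<le> cell_prob P Y s"
  unfolding cell_prob_def by (intro measure_pmf.finite_measure_mono Collect_mono impI) (use assms in blast, simp)

text \<open>Points outside the support carry no mass, so cells that agree on the support have equal
  probability. This is what regroups nested tuples.\<close>

lemma cell_prob_cong:
  assumes "s \<in> set_pmf P" and "\<And>t. t \<in> set_pmf P \<Longrightarrow> X t = X s \<longleftrightarrow> Y t = Y s"
  shows "cell_prob P X s = cell_prob P Y s"
  unfolding cell_prob_def using assms by (intro measure_prob_cong_0) (auto simp: pmf_eq_0_set_pmf)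

lemma cell_prob_pair:
  "cell_prob (pair_pmf A B) (\<lambda>z. (X (fst z), Y (snd z))) (a, b) = cell_prob A X a * cell_prob B Y b"
proof -
  have "map_pmf (\<lambda>z. (X (fst z), Y (snd z))) (pair_pmf A B) = pair_pmf (map_pmf X A) (map_pmf Y B)"
    by (simp add: map_pair [symmetric] case_prod_unfold)
  then show ?thesis
    by (simp add: cell_prob_eq_pmf pmf_pair)
qed

section \<open>Conditional entropy and mutual information as expectations\<close>

lemma distributed_pmf:
  fixes X :: "'s \<Rightarrow> 'a"
  shows "distributed (measure_pmf P) (count_space UNIV) X (\<lambda>x. ennreal (pmf (map_pmf X P) x))"
  unfolding distributed_def
proof (intro conjI)
  show "distr (measure_pmf P) (count_space UNIV) X =
      density (count_space UNIV) (\<lambda>x. ennreal (pmf (map_pmf X P) x))"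
    by (metis map_pmf_rep_eq measure_pmf_eq_density)
qed auto

lemma information_space_pmf: "information_space (measure_pmf P) 2"
  by unfold_locales auto

text \<open>The alphabets are countable, so the product of their counting measures is again a
  counting measure. The joint probability in front of the logarithm is absorbed into the law of
  \<open>(X, Y)\<close>, and pulling back along this pair gives an expectation under
  \<open>P\<close>.\<close>

lemma cond_entropy_eq:
  fixes X :: "'s \<Rightarrow> 'a::countable" and Y :: "'s \<Rightarrow> 'b::countable"
  shows "cond_entropy P X Y =
    measure_pmf.expectation P (\<lambda>s. log 2 (cell_prob P Y s / cell_prob P (\<lambda>s. (X s, Y s)) s))"
proof -
  let ?J = "map_pmf (\<lambda>s. (X s, Y s)) P"
  have pair: "count_space UNIV \<Otimes>\<^sub>M count_space UNIV = (count_space UNIV :: ('a \<times> 'b) measure)"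
    by (simp add: pair_measure_countable)
  have "cond_entropy P X Y = - (\<integral>(x, y). pmf ?J (x, y) * log 2 (pmf ?J (x, y) / pmf (map_pmf Y P) y)
      \<partial>(count_space UNIV \<Otimes>\<^sub>M count_space UNIV))"
    unfolding cond_entropy_def
    by (intro information_space.conditional_entropy_generic_eq[OF information_space_pmf] sigma_finite_measure_count_space_countable
        distributed_pmf) (auto simp: pair distributed_pmf)
  also have "\<dots> = - (\<integral>z. pmf ?J z * log 2 (pmf ?J z / pmf (map_pmf Y P) (snd z)) \<partial>count_space UNIV)"
    by (simp add: pair case_prod_unfold)
  also have "\<dots> = - (\<integral>z. log 2 (pmf ?J z / pmf (map_pmf Y P) (snd z)) \<partial>measure_pmf ?J)"
    by (subst measure_pmf_eq_density) (simp add: integral_real_density)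
  also have "\<dots> = (\<integral>s. - log 2 (cell_prob P (\<lambda>s. (X s, Y s)) s / cell_prob P Y s) \<partial>measure_pmf P)"
    by (simp add: cell_prob_eq_pmf)
  \<comment> \<open>The sign is absorbed by inverting the ratio; on the support both probabilities
    are positive.\<close>
  also have "\<dots> = measure_pmf.expectation P (\<lambda>s. log 2 (cell_prob P Y s / cell_prob P (\<lambda>s. (X s, Y s)) s))"
    by (intro Bochner_Integration.integral_cong_AE)
      (auto simp: AE_measure_pmf_iff log_divide cell_prob_neq_0)
  finally show ?thesis .
qed

lemma mutual_info_eq:
  fixes X :: "'s \<Rightarrow> 'a::countable" and Y :: "'s \<Rightarrow> 'b::countable"
  shows "mutual_info P X Y =
    measure_pmf.expectation P (\<lambda>s. log 2 (cell_prob P (\<lambda>s. (X s, Y s)) s / (cell_prob P X s * cell_prob P Y s)))"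
proof -
  let ?J = "map_pmf (\<lambda>s. (X s, Y s)) P"
  have pair: "count_space UNIV \<Otimes>\<^sub>M count_space UNIV = (count_space UNIV :: ('a \<times> 'b) measure)"
    by (simp add: pair_measure_countable)
  have "mutual_info P X Y = (\<integral>z. pmf ?J z * log 2 (pmf ?J z /
      (pmf (map_pmf X P) (fst z) * pmf (map_pmf Y P) (snd z))) \<partial>(count_space UNIV \<Otimes>\<^sub>M count_space UNIV))"
    unfolding mutual_info_def
    by (intro information_space.mutual_information_distr[OF information_space_pmf] sigma_finite_measure_count_space_countable
        distributed_pmf) (auto simp: pair distributed_pmf)
  also have "\<dots> = (\<integral>z. log 2 (pmf ?J z /
      (pmf (map_pmf X P) (fst z) * pmf (map_pmf Y P) (snd z))) \<partial>measure_pmf ?J)"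
    unfolding pair by (subst measure_pmf_eq_density[of ?J]) (simp add: integral_real_density)
  finally show ?thesis
    by (simp add: cell_prob_eq_pmf)
qed

section \<open>Change of measure and integrability of information densities\<close>

text \<open>Dividing by the joint probability cancels the weight that the expectation gives to a
  pair of values, which leaves a plain sum of \<open>g\<close>. Only an inequality results, since
  pairs of probability zero are missing on the left.\<close>

lemma nn_integral_div_cell_prob_le:
  fixes X :: "'s \<Rightarrow> 'a" and Y :: "'s \<Rightarrow> 'b" and g :: "'a \<Rightarrow> 'b \<Rightarrow> real"
  assumes fin: "finite (X ` set_pmf P)" and g: "\<And>x y. 0 \<le> g x y"
  shows "(\<integral>\<^sup>+s. ennreal (g (X s) (Y s) / cell_prob P (\<lambda>s. (X s, Y s)) s) \<partial>measure_pmf P)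
    \<le> (\<integral>\<^sup>+y. (\<Sum>x\<in>X ` set_pmf P. ennreal (g x y)) \<partial>count_space UNIV)"
proof -
  let ?J = "map_pmf (\<lambda>s. (X s, Y s)) P" and ?A = "X ` set_pmf P"
  have "(\<integral>\<^sup>+s. ennreal (g (X s) (Y s) / cell_prob P (\<lambda>s. (X s, Y s)) s) \<partial>measure_pmf P)
      = (\<integral>\<^sup>+z. ennreal (g (fst z) (snd z) / pmf ?J z) \<partial>measure_pmf ?J)"
    by (simp add: cell_prob_eq_pmf)
  also have "\<dots> = (\<integral>\<^sup>+z. ennreal (pmf ?J z) * ennreal (g (fst z) (snd z) / pmf ?J z) \<partial>count_space UNIV)"
    by (simp only: nn_integral_measure_pmf)
  also have "\<dots> \<le> (\<integral>\<^sup>+z. ennreal (g (fst z) (snd z)) * indicator ?A (fst z) \<partial>count_space UNIV)"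
  proof (intro nn_integral_mono)
    fix z
    show "ennreal (pmf ?J z) * ennreal (g (fst z) (snd z) / pmf ?J z)
        \<le> ennreal (g (fst z) (snd z)) * indicator ?A (fst z)"
    proof (cases "z \<in> set_pmf ?J")
      case True
      then have "pmf ?J z > 0" "fst z \<in> ?A"
        by (auto simp: pmf_positive)
      then show ?thesis
        by (simp add: ennreal_mult' [symmetric])
    next
      case False
      then have "pmf ?J z = 0"
        by (simp add: pmf_eq_0_set_pmf)
      then show ?thesis
        by simp
    qed
  qed
  also have "\<dots> = (\<integral>\<^sup>+y. \<integral>\<^sup>+x. ennreal (g x y) * indicator ?A x \<partial>count_space UNIV \<partial>count_space UNIV)"
    by (subst nn_integral_snd_count_space[of "\<lambda>(x,y). ennreal (g x y) * indicator ?A x", simplified case_prod_conv])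
      (simp add: case_prod_unfold)
  also have "\<dots> = (\<integral>\<^sup>+y. (\<Sum>x\<in>?A. ennreal (g x y)) \<partial>count_space UNIV)"
    using fin by (intro nn_integral_cong)
      (simp add: nn_integral_count_space_indicator[symmetric] nn_integral_count_space_finite)
  finally show ?thesis .
qed

text \<open>The sum over pairs is at most the total mass 1 of the law of \<open>Y\<close>, counted
  once for each of the finitely many values of \<open>X\<close>.\<close>

lemma integrable_div_cell_prob:
  fixes g :: "'a \<Rightarrow> 'b \<Rightarrow> real"
  assumes fin: "finite (X ` set_pmf P)" and g: "\<And>x y. 0 \<le> g x y"
    and le: "\<And>x y. g x y \<le> pmf (map_pmf Y P) y"
  shows "integrable (measure_pmf P) (\<lambda>s. g (X s) (Y s) / cell_prob P (\<lambda>s. (X s, Y s)) s)"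
proof (rule integrableI_bounded)
  have nonneg: "0 \<le> g (X s) (Y s) / cell_prob P (\<lambda>s. (X s, Y s)) s" for s
    using g by (simp add: cell_prob_def)
  have "(\<integral>\<^sup>+s. ennreal (norm (g (X s) (Y s) / cell_prob P (\<lambda>s. (X s, Y s)) s)) \<partial>measure_pmf P)
      \<le> (\<integral>\<^sup>+y. (\<Sum>x\<in>X ` set_pmf P. ennreal (g x y)) \<partial>count_space UNIV)"
    using nn_integral_div_cell_prob_le[OF fin g] nonneg by (simp only: real_norm_def abs_of_nonneg)
  also have "\<dots> \<le> (\<integral>\<^sup>+y. of_nat (card (X ` set_pmf P)) * ennreal (pmf (map_pmf Y P) y) \<partial>count_space UNIV)"
    using le by (intro nn_integral_mono sum_bounded_above ennreal_leI)
  also have "\<dots> < \<infinity>"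
    by (simp add: nn_integral_cmult nn_integral_pmf' flip: ennreal_of_nat_eq_real_of_nat)
      (simp add: ennreal_of_nat_eq_real_of_nat)
  finally show "(\<integral>\<^sup>+s. ennreal (norm (g (X s) (Y s) / cell_prob P (\<lambda>s. (X s, Y s)) s)) \<partial>measure_pmf P) < \<infinity>" .
qed simp

lemma expectation_div_cell_prob_le_1:
  fixes g :: "'a \<Rightarrow> 'b \<Rightarrow> real"
  assumes fin: "finite (X ` set_pmf P)" and g: "\<And>x y. 0 \<le> g x y"
    and le: "\<And>y. (\<Sum>x\<in>X ` set_pmf P. g x y) \<le> pmf (map_pmf Y P) y"
  shows "measure_pmf.expectation P (\<lambda>s. g (X s) (Y s) / cell_prob P (\<lambda>s. (X s, Y s)) s) \<le> 1"
proof -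
  have nonneg: "0 \<le> g (X s) (Y s) / cell_prob P (\<lambda>s. (X s, Y s)) s" for s
    using g by (simp add: cell_prob_def)
  have "(\<integral>\<^sup>+s. ennreal (g (X s) (Y s) / cell_prob P (\<lambda>s. (X s, Y s)) s) \<partial>measure_pmf P)
      \<le> (\<integral>\<^sup>+y. (\<Sum>x\<in>X ` set_pmf P. ennreal (g x y)) \<partial>count_space UNIV)"
    using fin g by (rule nn_integral_div_cell_prob_le)
  also have "\<dots> \<le> (\<integral>\<^sup>+y. ennreal (pmf (map_pmf Y P) y) \<partial>count_space UNIV)"
    using le g by (intro nn_integral_mono) (simp add: sum_ennreal ennreal_leI)
  also have "\<dots> = 1"
    by (simp add: nn_integral_pmf')
  finally show ?thesis
    using nonneg by (subst integral_eq_nn_integral) (auto intro!: enn2real_leI)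
qed

lemma cell_prob_ratio_ge_1:
  assumes "s \<in> set_pmf P"
  shows "1 \<le> cell_prob P Y s / cell_prob P (\<lambda>s. (X s, Y s)) s"
  using cell_prob_pos[OF assms, of "\<lambda>s. (X s, Y s)"] cell_prob_mono[of "\<lambda>s. (X s, Y s)" s Y P]
  by (simp add: le_divide_eq)

lemma log2_le: "0 < x \<Longrightarrow> log 2 x \<le> (x - 1) / ln 2" for x :: real
  using ln_le_minus_one[of x] by (simp add: log_def divide_right_mono)

text \<open>On the support the ratio is at least 1, so its logarithm lies between 0 and the ratio
  divided by \<open>ln 2\<close>. The ratio is integrable by the preceding change of measure with
  \<open>g x y\<close> the marginal probability of \<open>y\<close>. Finiteness is asked of
  \<open>X\<close> alone, so channel outputs may range over an infinite alphabet.\<close>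

lemma integrable_cond_information:
  assumes fin: "finite (X ` set_pmf P)"
  shows "integrable (measure_pmf P) (\<lambda>s. log 2 (cell_prob P Y s / cell_prob P (\<lambda>s. (X s, Y s)) s))"
proof (rule Bochner_Integration.integrable_bound)
  let ?t = "\<lambda>s. cell_prob P Y s / cell_prob P (\<lambda>s. (X s, Y s)) s"
  show "integrable (measure_pmf P) (\<lambda>s. ?t s / ln 2)"
    using integrable_div_cell_prob[OF fin, of "\<lambda>_ y. pmf (map_pmf Y P) y" Y]
    by (intro integrable_divide_zero) (simp add: cell_prob_eq_pmf)
  show "AE s in measure_pmf P. norm (log 2 (?t s)) \<le> norm (?t s / ln 2)"
  proof (rule AE_pmfI)
    fix s assume s: "s \<in> set_pmf P"
    have "log 2 (?t s) \<le> (?t s - 1) / ln 2"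
      using cell_prob_ratio_ge_1[OF s, of Y X] by (intro log2_le) linarith
    also have "\<dots> \<le> ?t s / ln 2"
      by (intro divide_right_mono) simp_all
    finally have "log 2 (?t s) \<le> ?t s / ln 2" .
    moreover have "0 \<le> log 2 (?t s)"
      using cell_prob_ratio_ge_1[OF s, of Y X] by simp
    ultimately show "norm (log 2 (?t s)) \<le> norm (?t s / ln 2)"
      unfolding real_norm_def by linarith
  qed
qed simp

section \<open>Basic laws of conditional entropy\<close>

lemma cond_entropy_nonneg:
  fixes X :: "'s \<Rightarrow> 'a::countable" and Y :: "'s \<Rightarrow> 'b::countable"
  shows "0 \<le> cond_entropy P X Y"
  unfolding cond_entropy_eq
proof (intro integral_nonneg_AE AE_pmfI)
  fix s assume "s \<in> set_pmf P"
  from cell_prob_ratio_ge_1[OF this, of Y X]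
  show "0 \<le> log 2 (cell_prob P Y s / cell_prob P (\<lambda>s. (X s, Y s)) s)"
    by simp
qed

lemma sum_pmf_Pair_le:
  assumes "finite A"
  shows "(\<Sum>x\<in>A. pmf (map_pmf (\<lambda>s. (X s, Z s)) P) (x, z)) \<le> pmf (map_pmf Z P) z"
proof -
  let ?J = "map_pmf (\<lambda>s. (X s, Z s)) P"
  have "(\<Sum>x\<in>A. pmf ?J (x, z)) = (\<Sum>w\<in>(\<lambda>x. (x, z)) ` A. pmf ?J w)"
    by (subst sum.reindex) (auto intro: inj_onI)
  also have "\<dots> = measure (measure_pmf ?J) ((\<lambda>x. (x, z)) ` A)"
    using assms by (intro measure_measure_pmf_finite[symmetric]) simp
  also have "\<dots> \<le> measure (measure_pmf ?J) (snd -` {z})"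
    by (intro measure_pmf.finite_measure_mono) auto
  also have "\<dots> = pmf (map_pmf Z P) z"
    by (simp add: pmf_map vimage_def)
  finally show ?thesis .
qed

text \<open>Gibbs' inequality: the difference of the two sides is the relative entropy of the law of
  \<open>(X, Y)\<close> with respect to the law \<open>g\<close> that makes \<open>X\<close> and
  \<open>Y\<close> conditionally independent given \<open>f Y\<close>. With \<open>t\<close> the
  ratio of the two laws, it suffices that \<open>-log 2 t\<close> is at least
  \<open>(1 - t) / ln 2\<close> and that \<open>t\<close> has expectation at most 1.\<close>

lemma cond_entropy_data_processing:
  fixes X :: "'s \<Rightarrow> 'a::countable" and Y :: "'s \<Rightarrow> 'b::countable" and f :: "'b \<Rightarrow> 'c::countable"
  assumes fin: "finite (X ` set_pmf P)"
  shows "cond_entropy P X Y \<le> cond_entropy P X (\<lambda>s. f (Y s))"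
proof -
  let ?Z = "\<lambda>s. f (Y s)"
  let ?a = "\<lambda>s. log 2 (cell_prob P Y s / cell_prob P (\<lambda>s. (X s, Y s)) s)"
  let ?b = "\<lambda>s. log 2 (cell_prob P ?Z s / cell_prob P (\<lambda>s. (X s, ?Z s)) s)"
  \<comment> \<open>The joint law of a Markov chain from \<open>X\<close> through \<open>f Y\<close>
    to \<open>Y\<close>. Where \<open>f y\<close> has probability zero, division by zero makes
    \<open>g\<close> vanish.\<close>
  define g where "g = (\<lambda>x y. pmf (map_pmf (\<lambda>s. (X s, ?Z s)) P) (x, f y) *
    (pmf (map_pmf Y P) y / pmf (map_pmf ?Z P) (f y)))"
  define t where "t = (\<lambda>s. g (X s) (Y s) / cell_prob P (\<lambda>s. (X s, Y s)) s)"
  have g_nonneg: "0 \<le> g x y" for x y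
    by (simp add: g_def)
  have g_sum: "(\<Sum>x\<in>A. g x y) \<le> pmf (map_pmf Y P) y" if "finite A" for A y
  proof -
    have "(\<Sum>x\<in>A. g x y) = (\<Sum>x\<in>A. pmf (map_pmf (\<lambda>s. (X s, ?Z s)) P) (x, f y)) *
        (pmf (map_pmf Y P) y / pmf (map_pmf ?Z P) (f y))"
      by (simp only: g_def sum_distrib_right)
    also have "\<dots> \<le> pmf (map_pmf ?Z P) (f y) * (pmf (map_pmf Y P) y / pmf (map_pmf ?Z P) (f y))"
      using that by (intro mult_right_mono sum_pmf_Pair_le) auto
    also have "\<dots> \<le> pmf (map_pmf Y P) y"
      by simp
    finally show ?thesis .
  qed
  have int_a: "integrable (measure_pmf P) ?a" and int_b: "integrable (measure_pmf P) ?b"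
    using fin by (rule integrable_cond_information)+
  \<comment> \<open>The pointwise bound on \<open>g\<close> is \<open>g_sum\<close> for
    singletons.\<close>
  have int_t: "integrable (measure_pmf P) t"
    unfolding t_def using fin g_nonneg g_sum[of "{x}" for x] by (intro integrable_div_cell_prob) auto
  have "measure_pmf.expectation P t \<le> 1"
    unfolding t_def using fin g_nonneg g_sum by (intro expectation_div_cell_prob_le_1) auto
  then have "0 \<le> measure_pmf.expectation P (\<lambda>s. (1 - t s) / ln 2)"
    using int_t by simp
  also have "\<dots> \<le> measure_pmf.expectation P (\<lambda>s. ?b s - ?a s)"
  proof (intro integral_mono_AE AE_pmfI)
    fix s assume s: "s \<in> set_pmf P"
    have t_eq: "t s = cell_prob P (\<lambda>s. (X s, ?Z s)) s * (cell_prob P Y s / cell_prob P ?Z s)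
        / cell_prob P (\<lambda>s. (X s, Y s)) s"
      by (simp add: t_def g_def cell_prob_eq_pmf)
    then have "0 < t s"
      by (simp add: cell_prob_pos[OF s])
    then have "(1 - t s) / ln 2 \<le> - log 2 (t s)"
      using log2_le[of "t s"] by (simp add: diff_divide_distrib)
    also have "\<dots> = ?b s - ?a s"
      unfolding t_eq by (simp add: log_divide log_mult cell_prob_neq_0[OF s])
    finally show "(1 - t s) / ln 2 \<le> ?b s - ?a s" .
  qed (use int_a int_b int_t in auto)
  finally show ?thesis
    using int_a int_b by (simp add: cond_entropy_eq)
qed

text \<open>The probability ratio telescopes pointwise through the cell of \<open>(Z, Y)\<close>.
  The finite ranges make both logarithms integrable, so that the expectation of their sum
  splits.\<close>

lemma cond_entropy_chain:
  fixes X :: "'s \<Rightarrow> 'a::countable" and Y :: "'s \<Rightarrow> 'b::countable" and Z :: "'s \<Rightarrow> 'c::countable"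
  assumes "finite (X ` set_pmf P)" "finite (Z ` set_pmf P)"
  shows "cond_entropy P (\<lambda>s. (X s, Z s)) Y = cond_entropy P Z Y + cond_entropy P X (\<lambda>s. (Z s, Y s))"
proof -
  have "cond_entropy P (\<lambda>s. (X s, Z s)) Y = measure_pmf.expectation P
      (\<lambda>s. log 2 (cell_prob P Y s / cell_prob P (\<lambda>s. (Z s, Y s)) s) +
           log 2 (cell_prob P (\<lambda>s. (Z s, Y s)) s / cell_prob P (\<lambda>s. (X s, Z s, Y s)) s))"
    unfolding cond_entropy_eq
  proof (intro integral_cong_AE AE_pmfI)
    fix s assume s: "s \<in> set_pmf P"
    have "cell_prob P (\<lambda>s. ((X s, Z s), Y s)) s = cell_prob P (\<lambda>s. (X s, Z s, Y s)) s"
      using s by (intro cell_prob_cong) auto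
    then show "log 2 (cell_prob P Y s / cell_prob P (\<lambda>s. ((X s, Z s), Y s)) s) =
        log 2 (cell_prob P Y s / cell_prob P (\<lambda>s. (Z s, Y s)) s) +
        log 2 (cell_prob P (\<lambda>s. (Z s, Y s)) s / cell_prob P (\<lambda>s. (X s, Z s, Y s)) s)"
      by (simp add: log_divide cell_prob_neq_0[OF s])
  qed auto
  then show ?thesis
    using assms by (simp add: cond_entropy_eq integrable_cond_information)
qed

text \<open>Conditional entropy depends only on the partition of the support by \<open>Y\<close> and
  on how \<open>X\<close> refines each of its cells. Hence injective recodings and repackings of
  tuples change nothing.\<close>

lemma cond_entropy_relabel:
  fixes X :: "'s \<Rightarrow> 'a::countable" and Y :: "'s \<Rightarrow> 'b::countable"
    and X' :: "'s \<Rightarrow> 'c::countable" and Y' :: "'s \<Rightarrow> 'd::countable"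
  assumes "\<And>s t. s \<in> set_pmf P \<Longrightarrow> t \<in> set_pmf P \<Longrightarrow> Y s = Y t \<longleftrightarrow> Y' s = Y' t"
    and "\<And>s t. s \<in> set_pmf P \<Longrightarrow> t \<in> set_pmf P \<Longrightarrow> Y s = Y t \<Longrightarrow> X s = X t \<longleftrightarrow> X' s = X' t"
  shows "cond_entropy P X Y = cond_entropy P X' Y'"
  unfolding cond_entropy_eq
proof (intro integral_cong_AE AE_pmfI)
  fix s assume s: "s \<in> set_pmf P"
  have "cell_prob P Y s = cell_prob P Y' s"
    using s assms by (intro cell_prob_cong) auto
  moreover have "cell_prob P (\<lambda>s. (X s, Y s)) s = cell_prob P (\<lambda>s. (X' s, Y' s)) s"
    using s assms by (intro cell_prob_cong) (simp_all, metis)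
  ultimately show "log 2 (cell_prob P Y s / cell_prob P (\<lambda>s. (X s, Y s)) s) =
      log 2 (cell_prob P Y' s / cell_prob P (\<lambda>s. (X' s, Y' s)) s)"
    by simp
qed auto

lemma cond_entropy_map_pmf:
  fixes X :: "'s \<Rightarrow> 'a::countable" and Y :: "'s \<Rightarrow> 'b::countable"
  shows "cond_entropy (map_pmf f P) X Y = cond_entropy P (\<lambda>s. X (f s)) (\<lambda>s. Y (f s))"
  by (simp add: cond_entropy_eq cell_prob_eq_pmf map_pmf_comp)

text \<open>By independence cell probabilities multiply, so the logarithm is a sum of two terms that
  each see one component, and each term is integrated against its own marginal.\<close>

lemma cond_entropy_pair_pmf:
  fixes X :: "'s \<Rightarrow> 'a::countable" and Y :: "'s \<Rightarrow> 'b::countable"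
    and X' :: "'t \<Rightarrow> 'c::countable" and Y' :: "'t \<Rightarrow> 'd::countable"
  assumes fin: "finite (X ` set_pmf A)" "finite (X' ` set_pmf B)"
  shows "cond_entropy (pair_pmf A B) (\<lambda>(a, b). (X a, X' b)) (\<lambda>(a, b). (Y a, Y' b))
    = cond_entropy A X Y + cond_entropy B X' Y'"
proof -
  let ?h = "\<lambda>a. log 2 (cell_prob A Y a / cell_prob A (\<lambda>a. (X a, Y a)) a)"
  let ?h' = "\<lambda>b. log 2 (cell_prob B Y' b / cell_prob B (\<lambda>b. (X' b, Y' b)) b)"
  have ent_fst: "integrable (measure_pmf (pair_pmf A B)) (\<lambda>z. ?h (fst z))"
    "measure_pmf.expectation (pair_pmf A B) (\<lambda>z. ?h (fst z)) = cond_entropy A X Y"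
    using integrable_cond_information[OF fin(1), of Y]
      integrable_map_pmf_eq[of fst "pair_pmf A B" ?h] integral_map_pmf[of fst "pair_pmf A B" ?h]
    by (simp_all add: cond_entropy_eq map_fst_pair_pmf)
  have ent_snd: "integrable (measure_pmf (pair_pmf A B)) (\<lambda>z. ?h' (snd z))"
    "measure_pmf.expectation (pair_pmf A B) (\<lambda>z. ?h' (snd z)) = cond_entropy B X' Y'"
    using integrable_cond_information[OF fin(2), of Y']
      integrable_map_pmf_eq[of snd "pair_pmf A B" ?h'] integral_map_pmf[of snd "pair_pmf A B" ?h']
    by (simp_all add: cond_entropy_eq map_snd_pair_pmf)
  have "cond_entropy (pair_pmf A B) (\<lambda>(a, b). (X a, X' b)) (\<lambda>(a, b). (Y a, Y' b)) =
      measure_pmf.expectation (pair_pmf A B) (\<lambda>z. ?h (fst z) + ?h' (snd z))"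
    unfolding cond_entropy_eq case_prod_unfold
  proof (intro integral_cong_AE AE_pmfI)
    fix z assume z: "z \<in> set_pmf (pair_pmf A B)"
    then have ab: "fst z \<in> set_pmf A" "snd z \<in> set_pmf B"
      by auto
    \<comment> \<open>Regrouping by component instead of by role lets the joint cell factor.\<close>
    have "cell_prob (pair_pmf A B) (\<lambda>z. ((X (fst z), X' (snd z)), (Y (fst z), Y' (snd z)))) z =
        cell_prob (pair_pmf A B) (\<lambda>z. ((X (fst z), Y (fst z)), (X' (snd z), Y' (snd z)))) z"
      using z by (intro cell_prob_cong) auto
    also have "\<dots> = cell_prob A (\<lambda>a. (X a, Y a)) (fst z) * cell_prob B (\<lambda>b. (X' b, Y' b)) (snd z)"
      using cell_prob_pair[where X="\<lambda>a. (X a, Y a)" and Y="\<lambda>b. (X' b, Y' b)" and a="fst z" and b="snd z"] by simp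
    finally show "log 2 (cell_prob (pair_pmf A B) (\<lambda>z. (Y (fst z), Y' (snd z))) z /
        cell_prob (pair_pmf A B) (\<lambda>z. ((X (fst z), X' (snd z)), (Y (fst z), Y' (snd z)))) z) =
        ?h (fst z) + ?h' (snd z)"
      using cell_prob_pair[where X=Y and Y=Y' and a="fst z" and b="snd z"]
      by (simp add: log_divide log_mult cell_prob_neq_0[OF ab(1)] cell_prob_neq_0[OF ab(2)])
  qed auto
  then show ?thesis
    using ent_fst ent_snd by simp
qed

section \<open>Memoryless sources and channels\<close>

lemma finite_set_replicate_pmf: "finite (set_pmf Q) \<Longrightarrow> finite (set_pmf (replicate_pmf n Q))"
  by (induction n) auto

lemma replicate_pmf_Suc_pair:
  "replicate_pmf (Suc n) Q = map_pmf (\<lambda>(x, xs). x # xs) (pair_pmf Q (replicate_pmf n Q))"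
  by (simp add: pair_pmf_def map_bind_pmf)

lemma cond_entropy_replicate_pmf:
  fixes X :: "'s \<Rightarrow> 'a::countable" and Y :: "'s \<Rightarrow> 'b::countable"
  assumes fin: "finite (X ` set_pmf P)"
  shows "cond_entropy (replicate_pmf n P) (map X) (map Y) = n * cond_entropy P X Y"
proof (induction n)
  case 0
  show ?case
    by (simp add: cond_entropy_eq cell_prob_def)
next
  case (Suc n)
  \<comment> \<open>The support of \<open>P\<close> may be infinite, so finiteness comes from
    counting lists of fixed length over the range of \<open>X\<close>.\<close>
  have fin': "finite (map X ` set_pmf (replicate_pmf n P))"
  proof (rule finite_subset)
    show "map X ` set_pmf (replicate_pmf n P) \<subseteq> {xs. set xs \<subseteq> X ` set_pmf P \<and> length xs = n}"
      by (auto simp: set_replicate_pmf)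
    show "finite {xs. set xs \<subseteq> X ` set_pmf P \<and> length xs = n}"
      using fin by (rule finite_lists_length_eq)
  qed
  have "cond_entropy (replicate_pmf (Suc n) P) (map X) (map Y) =
      cond_entropy (pair_pmf P (replicate_pmf n P)) (\<lambda>(a, b). (X a, map X b)) (\<lambda>(a, b). (Y a, map Y b))"
    unfolding replicate_pmf_Suc_pair cond_entropy_map_pmf by (rule cond_entropy_relabel) auto
  also have "\<dots> = cond_entropy P X Y + cond_entropy (replicate_pmf n P) (map X) (map Y)"
    using fin fin' by (rule cond_entropy_pair_pmf)
  finally show ?case
    using Suc by (simp add: algebra_simps)
qed

text \<open>Sending an i.i.d. block through independent channel uses amounts to drawing i.i.d.
  input-output pairs and unzipping them. This is what makes the equivocation of a block
  additive.\<close>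

lemma input_output_replicate:
  "input_output (replicate_pmf n Q) (channel_power W) =
    map_pmf (\<lambda>zs. (map fst zs, map snd zs)) (replicate_pmf n (input_output Q W))"
proof (induction n)
  case 0
  show ?case
    by (simp add: input_output_def bind_return_pmf)
next
  case (Suc n)
  have "input_output (replicate_pmf (Suc n) Q) (channel_power W) =
    do {x \<leftarrow> Q; xs \<leftarrow> replicate_pmf n Q; y \<leftarrow> W x; ys \<leftarrow> channel_power W xs; return_pmf (x # xs, y # ys)}"
    by (simp add: input_output_def bind_assoc_pmf bind_return_pmf)
  \<comment> \<open>The first output depends only on the first input, so it may be drawn before the
    remaining inputs.\<close>
  also have "\<dots> = do {x \<leftarrow> Q; y \<leftarrow> W x; xs \<leftarrow> replicate_pmf n Q; ys \<leftarrow> channel_power W xs; return_pmf (x # xs, y # ys)}"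
    by (subst bind_commute_pmf) (rule refl)
  also have "\<dots> = do {z \<leftarrow> input_output Q W; w \<leftarrow> input_output (replicate_pmf n Q) (channel_power W);
      return_pmf (fst z # fst w, snd z # snd w)}"
    by (simp add: input_output_def bind_assoc_pmf bind_return_pmf)
  also have "\<dots> = map_pmf (\<lambda>zs. (map fst zs, map snd zs)) (replicate_pmf (Suc n) (input_output Q W))"
    unfolding Suc by (simp add: map_pmf_def bind_assoc_pmf bind_return_pmf)
  finally show ?case .
qed

lemma map_fst_input_output: "map_pmf fst (input_output Q W) = Q"
  by (simp add: input_output_def map_bind_pmf bind_return_pmf')

text \<open>The unit-valued variable has a single cell of probability 1, so conditioning on it gives
  the unconditional entropy and the three-term logarithm splits into two information
  densities.\<close>

lemma mutual_info_eq_entropy_diff: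
  fixes X :: "'s \<Rightarrow> 'a::countable" and Y :: "'s \<Rightarrow> 'b::countable"
  assumes "finite (X ` set_pmf P)"
  shows "mutual_info P X Y = cond_entropy P X (\<lambda>_. ()) - cond_entropy P X Y"
proof -
  have "mutual_info P X Y = measure_pmf.expectation P
      (\<lambda>s. log 2 (cell_prob P (\<lambda>_. ()) s / cell_prob P (\<lambda>s. (X s, ())) s) -
           log 2 (cell_prob P Y s / cell_prob P (\<lambda>s. (X s, Y s)) s))"
    unfolding mutual_info_eq
  proof (intro integral_cong_AE AE_pmfI)
    fix s assume s: "s \<in> set_pmf P"
    have "cell_prob P (\<lambda>_. ()) s = 1" "cell_prob P (\<lambda>s. (X s, ())) s = cell_prob P X s"
      by (simp_all add: cell_prob_def)
    then show "log 2 (cell_prob P (\<lambda>s. (X s, Y s)) s / (cell_prob P X s * cell_prob P Y s)) =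
        log 2 (cell_prob P (\<lambda>_. ()) s / cell_prob P (\<lambda>s. (X s, ())) s) -
        log 2 (cell_prob P Y s / cell_prob P (\<lambda>s. (X s, Y s)) s)"
      by (simp add: log_divide log_mult cell_prob_neq_0[OF s])
  qed auto
  then show ?thesis
    using assms by (simp add: cond_entropy_eq integrable_cond_information)
qed

lemma entropy_bernoulli_bit:
  assumes "0 \<le> p" "p \<le> 1"
  shows "cond_entropy (bernoulli_bit p) (\<lambda>x. x) (\<lambda>_. ()) = binary_entropy p"
proof -
  \<comment> \<open>Since \<open>of_bool\<close> is injective, the computation can be done on
    booleans, where the expectation has two terms.\<close>
  have cell: "cell_prob (bernoulli_pmf p) (\<lambda>b. (of_bool b :: bit, ())) b = pmf (bernoulli_pmf p) b" for b
  proof -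
    have "{t. (of_bool t :: bit, ()) = (of_bool b, ())} = {b}"
      by auto
    then show ?thesis
      by (simp add: cell_prob_def pmf.rep_eq)
  qed
  have const: "cell_prob (bernoulli_pmf p) (\<lambda>_. ()) b = 1" for b
    by (simp add: cell_prob_def)
  have "cond_entropy (bernoulli_bit p) (\<lambda>x. x) (\<lambda>_. ()) =
      measure_pmf.expectation (bernoulli_pmf p) (\<lambda>b. log 2 (1 / pmf (bernoulli_pmf p) b))"
    unfolding bernoulli_bit_def cond_entropy_map_pmf by (simp only: cond_entropy_eq cell const)
  also have "\<dots> = binary_entropy p"
    using assms by (simp add: integral_bernoulli_pmf binary_entropy_def log_divide)
  finally show ?thesis .
qed

section \<open>The polar transform is an involution\<close>

text \<open>Division with remainder by \<open>k\<close> is a bijection from indices below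
  \<open>m * k\<close> to pairs; its inverse sends \<open>(a, b)\<close> to
  \<open>a * k + b\<close>.\<close>

lemma sum_div_mod:
  fixes f :: "nat \<Rightarrow> nat \<Rightarrow> 'a::comm_monoid_add"
  shows "(\<Sum>t<m * k. f (t div k) (t mod k)) = (\<Sum>a<m. \<Sum>b<k. f a b)"
proof -
  have "(\<Sum>t<m * k. f (t div k) (t mod k)) = (\<Sum>(a, b)\<in>{..<m} \<times> {..<k}. f a b)"
  proof (rule sum.reindex_bij_witness[of _ "\<lambda>(a, b). a * k + b" "\<lambda>t. (t div k, t mod k)"])
    fix t assume "t \<in> {..<m * k}"
    then show "(t div k, t mod k) \<in> {..<m} \<times> {..<k}"
      by (cases "k = 0") (auto simp: less_mult_imp_div_less)
  next
    fix z assume "z \<in> {..<m} \<times> {..<k}"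
    then obtain a b where z: "z = (a, b)" "a < m" "b < k"
      by auto
    have "a * k + b < Suc a * k"
      using z by simp
    also have "\<dots> \<le> m * k"
      using z by (intro mult_le_mono1) simp
    finally show "(case z of (a, b) \<Rightarrow> a * k + b) \<in> {..<m * k}"
      using z by simp
  qed auto
  then show ?thesis
    by (simp add: sum.cartesian_product)
qed

text \<open>The mixed-product rule. The inner summation index splits into quotient and remainder,
  and the resulting double sum factors.\<close>

lemma kronecker_prod_mult:
  fixes A :: "'a::comm_semiring_0 mat"
  assumes A: "A \<in> carrier_mat n m" and B: "B \<in> carrier_mat n' m'"
    and C: "C \<in> carrier_mat m k" and D: "D \<in> carrier_mat m' k'"
  shows "kronecker_prod A B * kronecker_prod C D = kronecker_prod (A * C) (B * D)"
proof (rule eq_matI)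
  fix i j assume "i < dim_row (kronecker_prod (A * C) (B * D))" "j < dim_col (kronecker_prod (A * C) (B * D))"
  then have ij: "i < n * n'" "j < k * k'"
    using assms by (auto simp: kronecker_prod_def)
  \<comment> \<open>An index below a product forces both factors to be positive, so the remainders
    are valid indices.\<close>
  then have "0 < n'" "0 < k'"
    by (auto intro!: gr0I)
  note bounds = less_mult_imp_div_less[OF ij(1)] less_mult_imp_div_less[OF ij(2)]
    mod_less_divisor[OF \<open>0 < n'\<close>, of i] mod_less_divisor[OF \<open>0 < k'\<close>, of j]
  let ?f = "\<lambda>a b. (A $$ (i div n', a) * B $$ (i mod n', b)) * (C $$ (a, j div k') * D $$ (b, j mod k'))"
  have "(kronecker_prod A B * kronecker_prod C D) $$ (i, j) = (\<Sum>t<m * m'. ?f (t div m') (t mod m'))"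
    using assms ij by (auto simp: kronecker_prod_def scalar_prod_def atLeast0LessThan intro!: sum.cong)
  also have "\<dots> = (\<Sum>a<m. \<Sum>b<m'. ?f a b)"
    by (rule sum_div_mod)
  also have "\<dots> = (\<Sum>a<m. A $$ (i div n', a) * C $$ (a, j div k')) * (\<Sum>b<m'. B $$ (i mod n', b) * D $$ (b, j mod k'))"
    by (simp add: sum_product ac_simps)
  also have "\<dots> = kronecker_prod (A * C) (B * D) $$ (i, j)"
    using assms ij bounds by (auto simp: kronecker_prod_def scalar_prod_def atLeast0LessThan)
  finally show "(kronecker_prod A B * kronecker_prod C D) $$ (i, j) = kronecker_prod (A * C) (B * D) $$ (i, j)" .
qed (use assms in \<open>auto simp: kronecker_prod_def\<close>)

lemma kronecker_prod_one: "kronecker_prod (1\<^sub>m m) (1\<^sub>m n) = (1\<^sub>m (m * n) :: 'a::semiring_1 mat)"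
proof (rule eq_matI)
  fix i j assume "i < dim_row (1\<^sub>m (m * n) :: 'a mat)" "j < dim_col (1\<^sub>m (m * n) :: 'a mat)"
  then have ij: "i < m * n" "j < m * n"
    by auto
  then have n: "0 < n"
    by (auto intro!: gr0I)
  have "i = j \<longleftrightarrow> i div n = j div n \<and> i mod n = j mod n"
    by (metis div_mult_mod_eq)
  then show "kronecker_prod (1\<^sub>m m) (1\<^sub>m n) $$ (i, j) = (1\<^sub>m (m * n) :: 'a mat) $$ (i, j)"
    using ij n by (auto simp: kronecker_prod_def less_mult_imp_div_less)
qed (auto simp: kronecker_prod_def)

text \<open>The lower left entry is 1 + 1, which is 0 over the field with two elements.\<close>

lemma polar_kernel_square:
  "mat_of_rows_list 2 [[1, 0], [1, 1]] * mat_of_rows_list 2 [[1, 0], [1, 1]] = (1\<^sub>m 2 :: bit mat)"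
  by (rule eq_matI) (auto simp: mat_of_rows_list_def scalar_prod_def less_2_cases_iff)

lemma polar_matrix_carrier: "polar_matrix l \<in> carrier_mat (2 ^ l) (2 ^ l)"
  unfolding polar_matrix_def
  by (induction l) (auto simp: mat_of_rows_list_def kronecker_prod_def intro!: carrier_matI)

lemma polar_matrix_square: "polar_matrix l * polar_matrix l = 1\<^sub>m (2 ^ l)"
proof (induction l)
  case 0
  show ?case
    by (simp add: polar_matrix_def)
next
  case (Suc l)
  let ?F = "mat_of_rows_list 2 [[1, 0], [1, 1]] :: bit mat"
  have "?F \<in> carrier_mat 2 2"
    by (auto simp: mat_of_rows_list_def carrier_matI)
  then have "kronecker_prod ?F (polar_matrix l) * kronecker_prod ?F (polar_matrix l) =
      kronecker_prod (?F * ?F) (polar_matrix l * polar_matrix l)"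
    using polar_matrix_carrier by (intro kronecker_prod_mult)
  then show ?case
    by (simp add: polar_matrix_def polar_kernel_square kronecker_prod_one Suc[unfolded polar_matrix_def])
qed

lemma length_polar_transform [simp]: "length (polar_transform l x) = 2 ^ l"
  using polar_matrix_carrier[of l] by (simp add: polar_transform_def)

text \<open>The transform multiplies by the transposed matrix, whose square is the transpose of
  \<open>G * G\<close> and hence the identity. Consequently the transformed block carries exactly
  the information of the input block.\<close>

lemma polar_transform_involution:
  assumes "length x = 2 ^ l"
  shows "polar_transform l (polar_transform l x) = x"
proof -
  let ?G = "polar_matrix l"
  have v: "vec_of_list x \<in> carrier_vec (2 ^ l)"
    using assms by (simp add: carrier_dim_vec)
  have G: "transpose_mat ?G \<in> carrier_mat (2 ^ l) (2 ^ l)"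
    using polar_matrix_carrier by simp
  have "transpose_mat ?G *\<^sub>v (transpose_mat ?G *\<^sub>v vec_of_list x) =
      (transpose_mat ?G * transpose_mat ?G) *\<^sub>v vec_of_list x"
    using assoc_mult_mat_vec[OF G G v] by simp
  also have "transpose_mat ?G * transpose_mat ?G = 1\<^sub>m (2 ^ l)"
    using transpose_mult[OF polar_matrix_carrier polar_matrix_carrier, of l]
    by (simp add: polar_matrix_square)
  finally show ?thesis
    using v by (simp add: polar_transform_def vec_list list_vec)
qed

lemma polar_transform_inject:
  assumes "length x = 2 ^ l" "length y = 2 ^ l"
  shows "polar_transform l x = polar_transform l y \<longleftrightarrow> x = y"
  using assms polar_transform_involution by metis

section \<open>The rate of the shaper\<close>

lemma finite_set_replicate_pmf_bit [simp]: "finite (set_pmf (replicate_pmf n (Q :: bit pmf)))"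
  by (rule finite_set_replicate_pmf) simp

section \<open>Entropy of a selection of coordinates\<close>

text \<open>Chain rule along the selected coordinates, by induction on the prefix length
  \<open>n\<close>. Each summand conditions on all earlier coordinates; these determine the selected
  ones among them, so conditioning on the latter alone can only raise the entropy.\<close>

lemma sum_cond_entropy_le_nths:
  fixes u :: "'s \<Rightarrow> 'a::countable list"
  assumes len: "\<And>s. length (u s) = N" and fin: "finite (set_pmf P)"
  shows "n \<le> N \<Longrightarrow> (\<Sum>i\<in>I \<inter> {..<n}. cond_entropy P (\<lambda>s. u s ! i) (\<lambda>s. take i (u s)))
    \<le> cond_entropy P (\<lambda>s. nths (take n (u s)) I) (\<lambda>_. ())"
proof (induction n)
  case 0
  show ?case
    by (simp add: cond_entropy_nonneg)
next
  case (Suc n)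
  let ?V = "\<lambda>n s. nths (take n (u s)) I"
  have step: "?V (Suc n) s = ?V n s @ (if n \<in> I then [u s ! n] else [])" for s
    using Suc.prems by (simp add: take_Suc_conv_app_nth len nths_append min_absorb2)
  show ?case
  proof (cases "n \<in> I")
    case False
    then have "I \<inter> {..<Suc n} = I \<inter> {..<n}"
      by (auto simp: less_Suc_eq)
    with False show ?thesis
      using Suc by (simp add: step)
  next
    case True
    then have "I \<inter> {..<Suc n} = insert n (I \<inter> {..<n})"
      by (auto simp: less_Suc_eq)
    then have "(\<Sum>i\<in>I \<inter> {..<Suc n}. cond_entropy P (\<lambda>s. u s ! i) (\<lambda>s. take i (u s))) =
        cond_entropy P (\<lambda>s. u s ! n) (\<lambda>s. take n (u s)) +
        (\<Sum>i\<in>I \<inter> {..<n}. cond_entropy P (\<lambda>s. u s ! i) (\<lambda>s. take i (u s)))"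
      by simp
    \<comment> \<open>The whole prefix is coarsened to its selected part; the added unit gives the
      condition the shape that the chain rule expects.\<close>
    also have "\<dots> \<le> cond_entropy P (\<lambda>s. u s ! n) (\<lambda>s. (?V n s, ())) + cond_entropy P (?V n) (\<lambda>_. ())"
      using Suc fin by (intro add_mono cond_entropy_data_processing[where f="\<lambda>v. (nths v I, ())"]) auto
    also have "\<dots> = cond_entropy P (\<lambda>s. (u s ! n, ?V n s)) (\<lambda>_. ())"
      using fin by (subst cond_entropy_chain) auto
    also have "\<dots> = cond_entropy P (?V (Suc n)) (\<lambda>_. ())"
      by (rule cond_entropy_relabel) (auto simp: step True)
    finally show ?thesis .
  qed
qed

lemma sum_cond_entropy_le_entropy_nths:
  fixes u :: "'s \<Rightarrow> 'a::countable list"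
  assumes len: "\<And>s. length (u s) = N" and fin: "finite (set_pmf P)" and I: "I \<subseteq> {..<N}"
  shows "(\<Sum>i\<in>I. cond_entropy P (\<lambda>s. u s ! i) (\<lambda>s. take i (u s)))
    \<le> cond_entropy P (\<lambda>s. nths (u s) I) (\<lambda>_. ())"
  using sum_cond_entropy_le_nths[OF len fin, where n=N and I=I] I by (simp add: len Int_absorb2)

section \<open>Entropies of a polarized block\<close>

definition block_joint :: "(bit \<Rightarrow> 'y pmf) \<Rightarrow> real \<Rightarrow> nat \<Rightarrow> (bit list \<times> 'y list) pmf" where
  "block_joint W p l = input_output (replicate_pmf (2 ^ l) (bernoulli_bit p)) (channel_power W)"

abbreviation equivocation :: "(bit \<Rightarrow> 'y::countable pmf) \<Rightarrow> real \<Rightarrow> real" where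
  "equivocation W p \<equiv> cond_entropy (input_output (bernoulli_bit p) W) fst snd"

lemma map_fst_block_joint: "map_pmf fst (block_joint W p l) = replicate_pmf (2 ^ l) (bernoulli_bit p)"
  by (simp add: block_joint_def map_fst_input_output)

lemma fst_set_block_joint: "fst ` set_pmf (block_joint W p l) = set_pmf (replicate_pmf (2 ^ l) (bernoulli_bit p))"
  by (simp flip: map_fst_block_joint[of W p l])

lemma length_fst_block_joint: "z \<in> set_pmf (block_joint W p l) \<Longrightarrow> length (fst z) = 2 ^ l"
  using imageI[of z "set_pmf (block_joint W p l)" fst] by (simp add: fst_set_block_joint set_replicate_pmf)

text \<open>The input blocks have finite support even if the outputs do not, so functions of the
  input satisfy the finiteness hypotheses of the entropy laws.\<close>

lemma finite_range_block_joint: "finite ((\<lambda>z. f (fst z)) ` set_pmf (block_joint W p l))"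
proof -
  have "finite (f ` fst ` set_pmf (block_joint W p l))"
    by (simp only: fst_set_block_joint finite_set_replicate_pmf_bit finite_imageI)
  then show ?thesis
    by (simp only: image_image)
qed

text \<open>Injectivity of the transform replaces U by X, and the block is then a list of i.i.d.
  input-output pairs, whose conditional entropies add.\<close>

lemma equivocation_block:
  fixes W :: "bit \<Rightarrow> 'y::countable pmf"
  shows "cond_entropy (block_joint W p l) (\<lambda>z. polar_transform l (fst z)) snd = 2 ^ l * equivocation W p"
proof -
  have "cond_entropy (block_joint W p l) (\<lambda>z. polar_transform l (fst z)) snd =
      cond_entropy (block_joint W p l) fst snd"
    by (rule cond_entropy_relabel) (auto simp: polar_transform_inject length_fst_block_joint)
  also have "\<dots> = cond_entropy (replicate_pmf (2 ^ l) (input_output (bernoulli_bit p) W)) (map fst) (map snd)"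
    by (simp add: block_joint_def input_output_replicate cond_entropy_map_pmf)
  also have "\<dots> = 2 ^ l * equivocation W p"
    by (subst cond_entropy_replicate_pmf) auto
  finally show ?thesis .
qed

lemma entropy_block:
  fixes W :: "bit \<Rightarrow> 'y::countable pmf"
  assumes p: "0 \<le> p" "p \<le> 1"
  shows "cond_entropy (block_joint W p l) (\<lambda>z. polar_transform l (fst z)) (\<lambda>_. ()) = 2 ^ l * binary_entropy p"
proof -
  let ?Q = "replicate_pmf (2 ^ l) (bernoulli_bit p)"
  have "cond_entropy (block_joint W p l) (\<lambda>z. polar_transform l (fst z)) (\<lambda>_. ()) =
      cond_entropy (block_joint W p l) fst (\<lambda>_. ())"
    by (rule cond_entropy_relabel) (auto simp: polar_transform_inject length_fst_block_joint)
  also have "\<dots> = cond_entropy ?Q (\<lambda>x. x) (\<lambda>_. ())"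
    by (simp add: cond_entropy_map_pmf flip: map_fst_block_joint[of W p l])
  \<comment> \<open>All blocks in the support have the same length, so a list of units is as
    constant as a single unit and the i.i.d. formula applies.\<close>
  also have "\<dots> = cond_entropy ?Q (map (\<lambda>x. x)) (map (\<lambda>_. ()))"
    by (rule cond_entropy_relabel) (auto simp: set_replicate_pmf map_replicate_const)
  also have "\<dots> = 2 ^ l * binary_entropy p"
    using p by (subst cond_entropy_replicate_pmf) (auto simp: entropy_bernoulli_bit)
  finally show ?thesis .
qed

text \<open>Membership in the set is the bound \<open>1 - e\<close> on the corresponding summand.
  The set is defined by the source alone, so the estimate is made there and carried to the joint law
  through its first marginal.\<close>

lemma entropy_high_entropy_set:
  fixes W :: "bit \<Rightarrow> 'y::countable pmf"
  shows "real (card (high_entropy_set p l e)) * (1 - e)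
    \<le> cond_entropy (block_joint W p l)
        (\<lambda>z. nths (polar_transform l (fst z)) (high_entropy_set p l e)) (\<lambda>_. ())"
proof -
  let ?R = "high_entropy_set p l e" and ?Q = "replicate_pmf (2 ^ l) (bernoulli_bit p)"
  have "real (card ?R) * (1 - e) \<le>
      (\<Sum>i\<in>?R. cond_entropy ?Q (\<lambda>x. polar_transform l x ! i) (\<lambda>x. take i (polar_transform l x)))"
    by (rule sum_bounded_below) (simp add: high_entropy_set_def)
  also have "\<dots> \<le> cond_entropy ?Q (\<lambda>x. nths (polar_transform l x) ?R) (\<lambda>_. ())"
    by (rule sum_cond_entropy_le_entropy_nths[of _ "2 ^ l"]) (auto simp: high_entropy_set_def)
  also have "\<dots> = cond_entropy (block_joint W p l) (\<lambda>z. nths (polar_transform l (fst z)) ?R) (\<lambda>_. ())"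
    by (simp add: cond_entropy_map_pmf flip: map_fst_block_joint[of W p l])
  finally show ?thesis .
qed

text \<open>The selected part is a function of \<open>U\<close>, so adjoining it to \<open>U\<close>
  is free and the chain rule applies.\<close>

lemma entropy_nths_split:
  fixes U :: "'s \<Rightarrow> 'a::countable list" and Y :: "'s \<Rightarrow> 'b::countable"
  assumes fin: "finite (U ` set_pmf P)"
  shows "cond_entropy P U Y =
    cond_entropy P (\<lambda>s. nths (U s) I) Y + cond_entropy P U (\<lambda>s. (nths (U s) I, Y s))"
proof -
  have "cond_entropy P U Y = cond_entropy P (\<lambda>s. (U s, nths (U s) I)) Y"
    by (rule cond_entropy_relabel) auto
  also have "\<dots> = cond_entropy P (\<lambda>s. nths (U s) I) Y + cond_entropy P U (\<lambda>s. (nths (U s) I, Y s))"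
    using fin finite_imageI[OF fin, of "\<lambda>u. nths u I"]
    by (intro cond_entropy_chain) (simp_all add: image_image)
  finally show ?thesis .
qed

text \<open>The rate equals \<open>r - 2 ^ l * equivocation W p\<close> plus the residual entropy
  H(U|V,Y). The two bounds come from the residual being nonnegative and being at most
  H(U|V).\<close>

lemma block_rate_bounds:
  fixes W :: "bit \<Rightarrow> 'y::countable pmf" and l :: nat and p e :: real
  assumes p: "0 \<le> p" "p \<le> 1"
  defines "r \<equiv> real (card (high_entropy_set p l e))"
  shows "r - 2 ^ l * equivocation W p \<le> block_rate W p l e"
    and "block_rate W p l e \<le> r - 2 ^ l * equivocation W p + (2 ^ l * binary_entropy p - r * (1 - e))"
proof -
  let ?J = "block_joint W p l" and ?R = "high_entropy_set p l e"
  let ?U = "\<lambda>z :: bit list \<times> 'y list. polar_transform l (fst z)"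
  let ?V = "\<lambda>z :: bit list \<times> 'y list. nths (?U z) ?R"
  note fin = finite_range_block_joint[of "polar_transform l" W p l]
  have rate: "block_rate W p l e = r - cond_entropy ?J ?V snd"
    by (simp add: block_rate_def Let_def block_joint_def r_def case_prod_unfold)
  have "cond_entropy ?J ?U (\<lambda>z. (?V z, snd z)) \<le> cond_entropy ?J ?U (\<lambda>z. (?V z, ()))"
    using cond_entropy_data_processing[OF fin, where Y="\<lambda>z. (?V z, snd z)" and f="\<lambda>(v, y). (v, ())"]
    by simp
  \<comment> \<open>Here H(U|V) is the entropy of the whole block minus H(V), and H(V) is at least
    \<open>r * (1 - e)\<close>.\<close>
  also have "\<dots> \<le> 2 ^ l * binary_entropy p - r * (1 - e)"
    using entropy_nths_split[OF fin, of "\<lambda>_. ()" ?R] entropy_high_entropy_set[of p l e W]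
    by (simp add: entropy_block[OF p] r_def)
  finally have "cond_entropy ?J ?U (\<lambda>z. (?V z, snd z)) \<le> 2 ^ l * binary_entropy p - r * (1 - e)" .
  moreover have "0 \<le> cond_entropy ?J ?U (\<lambda>z. (?V z, snd z))"
    by (rule cond_entropy_nonneg)
  moreover have "2 ^ l * equivocation W p = cond_entropy ?J ?V snd + cond_entropy ?J ?U (\<lambda>z. (?V z, snd z))"
    using entropy_nths_split[OF fin, of snd ?R] by (simp add: equivocation_block)
  ultimately show "r - 2 ^ l * equivocation W p \<le> block_rate W p l e"
    and "block_rate W p l e \<le> r - 2 ^ l * equivocation W p + (2 ^ l * binary_entropy p - r * (1 - e))"
    by (simp_all add: rate)
qed

lemma mutual_info_eq_binary_entropy_diff:
  fixes W :: "bit \<Rightarrow> 'y::countable pmf"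
  assumes p: "0 \<le> p" "p \<le> 1"
  shows "mutual_info (input_output (bernoulli_bit p) W) fst snd = binary_entropy p - equivocation W p"
proof -
  have "cond_entropy (input_output (bernoulli_bit p) W) fst (\<lambda>_. ()) =
      cond_entropy (map_pmf fst (input_output (bernoulli_bit p) W)) (\<lambda>x. x) (\<lambda>_. ())"
    by (simp only: cond_entropy_map_pmf)
  then show ?thesis
    using p by (simp add: mutual_info_eq_entropy_diff map_fst_input_output entropy_bernoulli_bit)
qed

section \<open>Passage to the limit\<close>

lemma powr_minus_blocklength_tendsto_0:
  fixes \<beta> :: real
  assumes \<beta>: "0 < \<beta>"
  shows "(\<lambda>l. 2 powr - (real (2 ^ l) powr \<beta>)) \<longlonglongrightarrow> 0"
proof -
  have "LIM l sequentially. (\<beta> * ln 2) * real l :> at_top"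
    using \<beta> by (intro filterlim_tendsto_pos_mult_at_top[OF tendsto_const _ filterlim_real_sequentially]) simp
  then have "LIM l sequentially. exp ((\<beta> * ln 2) * real l) :> at_top"
    by (rule filterlim_compose[OF exp_at_top])
  then have "LIM l sequentially. ln 2 * exp ((\<beta> * ln 2) * real l) :> at_top"
    by (rule filterlim_tendsto_pos_mult_at_top[OF tendsto_const, rotated]) simp
  then have "(\<lambda>l. exp (- (ln 2 * exp ((\<beta> * ln 2) * real l)))) \<longlonglongrightarrow> 0"
    by (intro filterlim_compose[OF exp_at_bot]) (simp add: filterlim_uminus_at_bot)
  then show ?thesis
    by (simp add: powr_def ln_realpow ac_simps)
qed

lemma tendsto_0_of_bigo:
  fixes f g :: "nat \<Rightarrow> real"
  assumes "f \<in> O(g)" and "g \<longlonglongrightarrow> 0"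
  shows "f \<longlonglongrightarrow> 0"
proof -
  have "g \<in> o(\<lambda>_. 1)"
    using assms(2) by (intro smalloI_tendsto) simp_all
  with assms(1) have "f \<in> o(\<lambda>_. 1)"
    by (rule landau_o.big_small_trans)
  from smalloD_tendsto[OF this] show ?thesis
    by simp
qed

text \<open>Squeezing: after division by the block length the bounds differ by
  \<open>binary_entropy p - r l * (1 - e l)\<close>, which tends to 0 because \<open>r\<close> tends
  to the binary entropy and \<open>e\<close> to 0.\<close>

lemma block_rate_tendsto:
  fixes W :: "bit \<Rightarrow> 'y::countable pmf"
  assumes p: "0 \<le> p" "p \<le> 1"
    and eps: "e \<longlonglongrightarrow> 0"
    and card: "(\<lambda>l. real (card (high_entropy_set p l (e l))) / 2 ^ l) \<longlonglongrightarrow> binary_entropy p"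
  shows "(\<lambda>l. block_rate W p l (e l) / 2 ^ l) \<longlonglongrightarrow> binary_entropy p - equivocation W p"
proof -
  define r where "r = (\<lambda>l. real (card (high_entropy_set p l (e l))) / 2 ^ l)"
  have r: "r \<longlonglongrightarrow> binary_entropy p"
    using card by (simp add: r_def)
  have lower: "r l - equivocation W p \<le> block_rate W p l (e l) / 2 ^ l" for l
    using divide_right_mono[OF block_rate_bounds(1)[OF p, where l=l and e="e l" and W=W], of "2 ^ l"]
    by (simp add: r_def diff_divide_distrib)
  have upper: "block_rate W p l (e l) / 2 ^ l
      \<le> r l - equivocation W p + (binary_entropy p - r l * (1 - e l))" for l
    using divide_right_mono[OF block_rate_bounds(2)[OF p, where l=l and e="e l" and W=W], of "2 ^ l"]
    by (simp add: r_def diff_divide_distrib add_divide_distrib)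
  have lower_lim: "(\<lambda>l. r l - equivocation W p) \<longlonglongrightarrow> binary_entropy p - equivocation W p"
    by (intro tendsto_intros r)
  have upper_lim: "(\<lambda>l. r l - equivocation W p + (binary_entropy p - r l * (1 - e l)))
      \<longlonglongrightarrow> binary_entropy p - equivocation W p"
    using tendsto_add[OF tendsto_diff[OF r tendsto_const[of "equivocation W p"]]
        tendsto_diff[OF tendsto_const tendsto_mult[OF r tendsto_diff[OF tendsto_const eps]]],
        of "binary_entropy p" 1]
    by simp
  show ?thesis
    by (rule tendsto_sandwich[OF _ _ lower_lim upper_lim]; intro always_eventually allI lower upper)
qed

theorem theorem2:
  fixes W :: "bit \<Rightarrow> 'y::countable pmf"
    and p \<beta> :: real
    and \<epsilon> :: "nat \<Rightarrow> real"
  assumes p: "0 \<le> p" "p \<le> 1"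
    and capacity_achieving:
      "mutual_info (input_output (bernoulli_bit p) W) fst snd = capacity W"
    and \<beta>: "0 < \<beta>" "\<beta> < 1 / 2"
    and \<epsilon>_bound:
      "(\<lambda>l. \<epsilon> (2 ^ l)) \<in> O(\<lambda>l. 2 powr - (real (2 ^ l) powr \<beta>))"
    and source_polarization:
      "(\<lambda>l. real (card (high_entropy_set p l (\<epsilon> (2 ^ l)))) - real (2 ^ l) * binary_entropy p)
         \<in> o(\<lambda>l. real (2 ^ l))"
  shows "(\<lambda>l. block_rate W p l (\<epsilon> (2 ^ l)) / real (2 ^ l)) \<longlonglongrightarrow> capacity W"
proof -
  have eps: "(\<lambda>l. \<epsilon> (2 ^ l)) \<longlonglongrightarrow> 0"
    using \<epsilon>_bound powr_minus_blocklength_tendsto_0[OF \<beta>(1)] by (rule tendsto_0_of_bigo)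
  \<comment> \<open>Dividing the sublinear polarization error by the block length gives convergence
    of the fraction of high-entropy indices.\<close>
  have "(\<lambda>l. real (card (high_entropy_set p l (\<epsilon> (2 ^ l)))) / 2 ^ l - binary_entropy p) \<longlonglongrightarrow> 0"
    using smalloD_tendsto[OF source_polarization] by (simp add: diff_divide_distrib)
  then have "(\<lambda>l. real (card (high_entropy_set p l (\<epsilon> (2 ^ l)))) / 2 ^ l) \<longlonglongrightarrow> binary_entropy p"
    by (simp add: LIM_zero_iff)
  from block_rate_tendsto[OF p eps this, of W] show ?thesis
    using mutual_info_eq_binary_entropy_diff[OF p, of W] capacity_achieving by simp
qed

end
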